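(* Let $m\ge2$. For every $n\ge1$ and every $q\in\{0,\dots,m-1\}$: (1) $c_m(m(mn+q+1)+1)\equiv 1+(q+1)\,c_m(mn+1)\pmod m$; (2) $\overline{b}_m(m(mn+q))\equiv(2q+1)\,\overline{b}_m(mn)\pmod m$.
   Context: For $m\ge2$ and $n\in\mathbb N_0$, $c_m(n)$ is the number of representations $n=n_0+n_1m+\dots+n_tm^t$ with all $n_i\in\mathbb N_0$ and such that for every $j\ge1$, $n_j>0$ implies $n_{j-1}>0$ ($m$-ary partitions with no gaps). The sequence $(\overline{b}_m(n))_{n\in\mathbb N_0}$ is defined by $\overline{b}_m(0)=1$, $\overline{b}_m(mn)=\overline{b}_m(mn+1)=\dots=\overline{b}_m(mn+m-1)$ for $n\ge0$, and $\overline{b}_m(mn)-\overline{b}_m(mn-1)=\overline{b}_m(n)+\overline{b}_m(n-1)$ for $n\ge1$. *)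

theory Defs
  imports "HOL-Number_Theory.Cong"
begin

text \<open>
  A representation \<open>n = a 0 + a 1 * m + \<dots> + a t * m ^ t\<close> is encoded as a function on all of
  \<open>nat\<close> that vanishes beyond some \<open>t\<close>, so that representations differing only in trailing
  zeros are identified.
\<close>

definition no_gap_reps :: "nat \<Rightarrow> nat \<Rightarrow> (nat \<Rightarrow> nat) set" where
  "no_gap_reps m n =
     {a. (\<exists>t. (\<forall>j>t. a j = 0) \<and> n = (\<Sum>j\<le>t. a j * m ^ j)) \<and>
         (\<forall>j\<ge>1. a j > 0 \<longrightarrow> a (j - 1) > 0)}"

definition c :: "nat \<Rightarrow> nat \<Rightarrow> nat" where
  "c m n = card (no_gap_reps m n)"

text \<open>Finiteness, so that the cardinality above is a genuine count.\<close>

lemma finite_no_gap_reps: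
  assumes "m \<ge> 2"
  shows "finite (no_gap_reps m n)"
proof (rule finite_subset)
  show "no_gap_reps m n \<subseteq> {a. \<forall>j. (j \<in> {..n} \<longrightarrow> a j \<in> {..n}) \<and> (j \<notin> {..n} \<longrightarrow> a j = 0)}"
  proof
    fix a assume "a \<in> no_gap_reps m n"
    then obtain t where t: "\<forall>j>t. a j = 0" "n = (\<Sum>j\<le>t. a j * m ^ j)"
      by (auto simp: no_gap_reps_def)
    have le: "a j * m ^ j \<le> n" for j
    proof (cases "j \<le> t")
      case True
      then show ?thesis unfolding t(2)
        using member_le_sum[of j "{..t}" "\<lambda>j. a j * m ^ j"] by simp
    qed (use t(1) in auto)
    have "a j \<le> n" for j
    proof -
      have "a j * 1 \<le> a j * m ^ j"
        using assms by (intro mult_left_mono) auto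
      then show ?thesis using le[of j] by linarith
    qed
    moreover have "a j = 0" if "j > n" for j
    proof (rule ccontr)
      assume "a j \<noteq> 0"
      then have "1 * m ^ j \<le> a j * m ^ j"
        by (intro mult_right_mono) auto
      moreover have "2 ^ j \<le> m ^ j"
        using assms by (intro power_mono) auto
      moreover have "j < 2 ^ j"
        by (rule less_exp)
      ultimately show False using le[of j] that by linarith
    qed
    ultimately show "a \<in> {a. \<forall>j. (j \<in> {..n} \<longrightarrow> a j \<in> {..n}) \<and> (j \<notin> {..n} \<longrightarrow> a j = 0)}"
      by auto
  qed
  show "finite {a. \<forall>j. (j \<in> {..n} \<longrightarrow> a j \<in> {..n}) \<and> (j \<notin> {..n} \<longrightarrow> a j = (0::nat))}"
    by (rule finite_set_of_finite_funs) auto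
qed

text \<open>
  The test \<open>m < 2\<close> only serves termination. For \<open>m \<ge> 2\<close>, the function is the unique sequence
  satisfying the three relations \<open>bbar_0\<close>, \<open>bbar_block\<close>, \<open>bbar_rec\<close> below (\<open>bbar_unique\<close>).
\<close>

function bbar :: "nat \<Rightarrow> nat \<Rightarrow> nat" where
  "bbar m k =
     (if m < 2 \<or> k < m then 1
      else bbar m (m * (k div m) - 1) + bbar m (k div m) + bbar m (k div m - 1))"
  by auto
termination
proof (relation "measure snd", goal_cases)
  case (2 m k)
  have "0 < m * (k div m)" using 2 by (auto simp: div_greater_zero_iff)
  moreover have "m * (k div m) \<le> k" by simp
  ultimately show ?case by (simp only: in_measure snd_conv)
next
  case (3 m k)
  then show ?case by simp
next
  case (4 m k)
  have "k div m \<le> k" "0 < k div m" using 4 by (auto simp: div_greater_zero_iff)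
  then show ?case by (simp only: in_measure snd_conv)
qed auto

declare bbar.simps [simp del]

lemma bbar_0: "m \<ge> 2 \<Longrightarrow> bbar m 0 = 1"
  by (simp add: bbar.simps)

lemma bbar_block:
  assumes "m \<ge> 2" "r < m"
  shows "bbar m (m * n + r) = bbar m (m * n)"
proof (cases "n = 0")
  case True
  then show ?thesis using assms by (simp add: bbar.simps)
next
  case False
  have "(m * n + r) div m = n" "(m * n) div m = n" using assms by auto
  moreover have "\<not> (m < 2 \<or> m * n + r < m)" "\<not> (m < 2 \<or> m * n < m)"
    using False assms by (auto simp: not_less intro: trans_le_add1)
  ultimately show ?thesis
    using bbar.simps[of m "m * n + r"] bbar.simps[of m "m * n"] by presburger
qed

lemma bbar_rec:
  assumes "m \<ge> 2" "n \<ge> 1"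
  shows "int (bbar m (m * n)) - int (bbar m (m * n - 1)) = int (bbar m n) + int (bbar m (n - 1))"
proof -
  have "(m * n) div m = n" "m \<le> m * n" using assms by auto
  then show ?thesis using assms by (subst bbar.simps) simp
qed

lemma bbar_unique:
  fixes f :: "nat \<Rightarrow> int"
  assumes m: "m \<ge> 2"
    and f0: "f 0 = 1"
    and block: "\<And>n r. r < m \<Longrightarrow> f (m * n + r) = f (m * n)"
    and rec: "\<And>n. n \<ge> 1 \<Longrightarrow> f (m * n) - f (m * n - 1) = f n + f (n - 1)"
  shows "f k = int (bbar m k)"
proof (induction k rule: less_induct)
  case (less k)
  define n where "n = k div m"
  have k: "k = m * n + k mod m" by (simp add: n_def)
  have fk: "f k = f (m * n)" using block[of "k mod m" n] k m by simp
  have bk: "bbar m k = bbar m (m * n)" using bbar_block[of m "k mod m" n] k m by simp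
  show ?case
  proof (cases "n = 0")
    case True
    then show ?thesis using fk bk f0 bbar_0[OF m] by simp
  next
    case False
    have "m * n \<le> k" using k by linarith
    moreover have "2 * n \<le> m * n" using m by simp
    ultimately have "m * n - 1 < k" "n < k" "n - 1 < k" using False by linarith+
    then show ?thesis
      using less.IH[of "m * n - 1"] less.IH[of n] less.IH[of "n - 1"]
        rec[of n] bbar_rec[OF m, of n] False fk bk by simp
  qed
qed

end

theory Submission
  imports Defs
begin

text \<open>
  In a nonempty gap-free representation the number of parts 1 is positive; removing these parts and
  dividing by \<open>m\<close> leaves an arbitrary gap-free representation. Hence \<open>c m N\<close> is the sum of
  \<open>c m j\<close> over all \<open>j\<close> with \<open>m * j < N\<close>, and it is constant on the blocks
  \<open>m * k + 1, \<dots>, m * k + m\<close>. Likewise, \<open>bbar m (m * K)\<close> telescopes to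
  \<open>bbar m K + 2 * (\<Sum>k<K. bbar m k)\<close>. Modulo \<open>m\<close>, every complete block cancels from these sums.
\<close>

lemma sum_blockwise_constant:
  fixes f :: "nat \<Rightarrow> 'a::comm_semiring_1"
  assumes block: "\<And>i r. r < m \<Longrightarrow> f (m * i + r) = f (m * i)"
    and "q \<le> m"
  shows "sum f {..<m * n + q} = of_nat m * (\<Sum>i<n. f (m * i)) + of_nat q * f (m * n)"
proof -
  \<comment> \<open>The case \<open>r = m\<close> is included because the induction on
    \<open>n\<close> below adds a whole block at a time.\<close>
  have partial: "sum f {..<m * i + r} = sum f {..<m * i} + of_nat r * f (m * i)" if "r \<le> m" for i r
    using that
  proof (induction r)
    case (Suc r)
    then show ?case using block[of r i] by (simp add: distrib_right add_ac)
  qed simp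
  have "sum f {..<m * n} = of_nat m * (\<Sum>i<n. f (m * i))"
  proof (induction n)
    case (Suc n)
    then show ?case using partial[of m n] by (simp add: algebra_simps)
  qed simp
  then show ?thesis using partial[OF \<open>q \<le> m\<close>] by simp
qed

text \<open>By the gap condition, a zero at index 0 propagates to every index and forces the
  represented number to be 0.\<close>

lemma no_gap_reps_pos:
  assumes "a \<in> no_gap_reps m n" "n > 0"
  shows "a 0 > 0"
proof (rule ccontr)
  assume "\<not> a 0 > 0"
  then have "a j = 0" for j
    using assms(1) by (induction j) (fastforce simp: no_gap_reps_def)+
  then show False using assms by (auto simp: no_gap_reps_def)
qed

lemma no_gap_reps_tail:
  assumes "a \<in> no_gap_reps m n"
  obtains j where "(\<lambda>i. a (Suc i)) \<in> no_gap_reps m j" "n = a 0 + m * j"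
proof -
  obtain t where t: "\<forall>j>t. a j = 0" "n = (\<Sum>j\<le>t. a j * m ^ j)"
    and gap: "\<forall>j\<ge>1. a j > 0 \<longrightarrow> a (j - 1) > 0"
    using assms by (auto simp: no_gap_reps_def)
  \<comment> \<open>The added term is zero; splitting off index 0 then leaves a sum over indices up
    to \<open>t\<close> again.\<close>
  have "n = (\<Sum>j\<le>Suc t. a j * m ^ j)" using t by simp
  also have "\<dots> = a 0 + m * (\<Sum>j\<le>t. a (Suc j) * m ^ j)"
    by (subst sum.atMost_Suc_shift) (simp add: sum_distrib_left mult_ac)
  finally have "n = a 0 + m * (\<Sum>j\<le>t. a (Suc j) * m ^ j)" .
  moreover have "a j > 0" if "a (Suc j) > 0" for j
    using gap[rule_format, of "Suc j"] that by simp
  then have "(\<lambda>i. a (Suc i)) \<in> no_gap_reps m (\<Sum>j\<le>t. a (Suc j) * m ^ j)"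
    using t(1) unfolding no_gap_reps_def
    by (auto intro!: exI[of _ t] simp: Suc_le_eq gr0_conv_Suc)
  ultimately show ?thesis using that by blast
qed

text \<open>Converse of \<open>no_gap_reps_tail\<close>: \<open>x > 0\<close> supplies the gap
  condition at index 1, where \<open>b\<close> begins.\<close>

lemma no_gap_reps_cons:
  assumes "b \<in> no_gap_reps m j" "x > 0"
  shows "case_nat x b \<in> no_gap_reps m (x + m * j)"
proof -
  obtain t where t: "\<forall>j>t. b j = 0" "j = (\<Sum>j\<le>t. b j * m ^ j)"
    and gap: "\<forall>j\<ge>1. b j > 0 \<longrightarrow> b (j - 1) > 0"
    using assms by (auto simp: no_gap_reps_def)
  have "x + m * j = (\<Sum>i\<le>Suc t. case_nat x b i * m ^ i)"
    by (subst sum.atMost_Suc_shift) (simp add: t(2) sum_distrib_left mult_ac)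
  moreover have "\<forall>i>Suc t. case_nat x b i = 0"
    using t(1) by (auto split: nat.split)
  moreover have "\<forall>i\<ge>1. case_nat x b i > 0 \<longrightarrow> case_nat x b (i - 1) > 0"
  proof (intro allI impI)
    fix i assume i: "i \<ge> 1" "case_nat x b i > 0"
    then obtain i' where "i = Suc i'" by (cases i) auto
    then show "case_nat x b (i - 1) > 0"
      using i(2) gap[rule_format, of i'] assms(2) by (cases i') auto
  qed
  ultimately show ?thesis unfolding no_gap_reps_def by blast
qed

lemma c_0: "c m 0 = 1"
proof -
  have "no_gap_reps m 0 = {\<lambda>_. 0}"
  proof (intro equalityI subsetI)
    fix a assume a: "a \<in> no_gap_reps m 0"
    then have "a 0 = 0"
      by (rule no_gap_reps_tail) simp
    then have "a j = 0" for j
      using a by (induction j) (fastforce simp: no_gap_reps_def)+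
    then show "a \<in> {\<lambda>_. 0}" by auto
  qed (auto simp: no_gap_reps_def)
  then show ?thesis by (simp add: c_def)
qed

text \<open>Representations are sorted by the number \<open>j\<close> that their tail represents. As
  \<open>r\<close> is absent from the right-hand side, this also yields the constancy of
  \<open>c m\<close> on blocks.\<close>

lemma c_rec:
  assumes "m \<ge> 2" "r < m"
  shows "c m (m * k + r + 1) = (\<Sum>j\<le>k. c m j)"
proof -
  let ?N = "m * k + r + 1"
  have less_iff: "m * j < ?N \<longleftrightarrow> j \<le> k" for j
  proof
    assume "m * j < ?N"
    also have "?N \<le> m * Suc k" using assms by simp
    finally show "j \<le> k" using assms by (simp only: mult_less_cancel1) simp
  next
    assume "j \<le> k"
    then have "m * j \<le> m * k" by simp
    then show "m * j < ?N" by linarith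
  qed
  \<comment> \<open>The tail forces the first entry to be \<open>?N - m * j\<close>; by
    \<open>less_iff\<close> it is positive exactly when \<open>j \<le> k\<close>.\<close>
  have "bij_betw (\<lambda>(j, b). case_nat (?N - m * j) b) (SIGMA j:{..k}. no_gap_reps m j)
      (no_gap_reps m ?N)"
    unfolding bij_betw_def
  proof (intro conjI equalityI subsetI)
    show "inj_on (\<lambda>(j, b). case_nat (?N - m * j) b) (SIGMA j:{..k}. no_gap_reps m j)"
    proof (intro inj_onI, elim SigmaE, simp only: prod.case prod.inject)
      fix j b j' b'
      assume jj: "j \<in> {..k}" "j' \<in> {..k}"
        and eq: "case_nat (?N - m * j) b = case_nat (?N - m * j') b'"
      have "?N - m * j = ?N - m * j'" using fun_cong[OF eq, of 0] by simp
      moreover have "m * j < ?N" "m * j' < ?N" using jj less_iff by blast+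
      ultimately have "m * j = m * j'" by linarith
      moreover have "b i = b' i" for i using fun_cong[OF eq, of "Suc i"] by simp
      ultimately show "j = j' \<and> b = b'" using assms by auto
    qed
  next
    fix a assume "a \<in> (\<lambda>(j, b). case_nat (?N - m * j) b) ` (SIGMA j:{..k}. no_gap_reps m j)"
    then obtain j b where j: "j \<le> k" "b \<in> no_gap_reps m j" "a = case_nat (?N - m * j) b"
      by auto
    then show "a \<in> no_gap_reps m ?N"
      using no_gap_reps_cons[of b m j "?N - m * j"] less_iff[of j] by simp
  next
    fix a assume a: "a \<in> no_gap_reps m ?N"
    then obtain j where j: "(\<lambda>i. a (Suc i)) \<in> no_gap_reps m j" "?N = a 0 + m * j"
      by (rule no_gap_reps_tail)
    have "a 0 > 0" using no_gap_reps_pos[OF a] by simp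
    then have "j \<le> k" using j(2) less_iff[of j] by linarith
    moreover have "a = case_nat (?N - m * j) (\<lambda>i. a (Suc i))"
      using j(2) by (auto simp: fun_eq_iff split: nat.split)
    ultimately show "a \<in> (\<lambda>(j, b). case_nat (?N - m * j) b) ` (SIGMA j:{..k}. no_gap_reps m j)"
      using j(1) by (intro image_eqI[of _ _ "(j, \<lambda>i. a (Suc i))"]) auto
  qed
  then have "c m ?N = card (SIGMA j:{..k}. no_gap_reps m j)"
    unfolding c_def by (rule bij_betw_same_card[symmetric])
  then show ?thesis
    using finite_no_gap_reps[OF assms(1)] by (simp add: c_def)
qed

text \<open>By block constancy \<open>bbar m (m * k - 1)\<close> equals
  \<open>bbar m (m * (k - 1))\<close>, so summing the recurrence over \<open>k\<close> from 1 to
  \<open>K\<close> telescopes on the left and counts each inner value twice on the right.\<close>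

lemma bbar_mult_eq_sum:
  assumes "m \<ge> 2"
  shows "bbar m (m * K) = bbar m K + 2 * (\<Sum>k<K. bbar m k)"
proof (induction K)
  case (Suc K)
  have "m * Suc K - 1 = m * K + (m - 1)" using assms by simp
  then have "bbar m (m * Suc K - 1) = bbar m (m * K)"
    using bbar_block[OF assms, of "m - 1" K] assms by simp
  then have "int (bbar m (m * Suc K)) = int (bbar m (m * K)) + int (bbar m (Suc K)) + int (bbar m K)"
    using bbar_rec[OF assms, of "Suc K"] by simp
  then have "bbar m (m * Suc K) = bbar m (m * K) + bbar m (Suc K) + bbar m K"
    by (simp only: of_nat_add[symmetric] of_nat_eq_iff)
  then show ?case using Suc by simp
qed simp

theorem theorem11:
  fixes m n q :: nat
  assumes "m \<ge> 2" and "n \<ge> 1" and "q \<in> {0..m - 1}"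
  shows "[c m (m * (m * n + q + 1) + 1) = 1 + (q + 1) * c m (m * n + 1)] (mod m)
       \<and> [bbar m (m * (m * n + q)) = (2 * q + 1) * bbar m (m * n)] (mod m)"
proof
  have q: "q < m" using assms by auto
  have "c m (m * (m * n + q + 1) + 1) = (\<Sum>j\<le>m * n + q + 1. c m j)"
    using c_rec[of m 0 "m * n + q + 1"] assms(1) by (simp only: add_0_right)
  \<comment> \<open>The term \<open>c m 0 = 1\<close> is the summand 1 of the claim; removing it
    shifts the index so that blocks start at multiples of \<open>m\<close>.\<close>
  also have "\<dots> = 1 + (\<Sum>j<m * n + (q + 1). c m (j + 1))"
    using sum.atMost_Suc_shift[of "c m" "m * n + q"] by (simp add: c_0 lessThan_Suc_atMost)
  \<comment> \<open>For \<open>q = m - 1\<close> the last block is complete, which the bound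
    \<open>q \<le> m\<close> in \<open>sum_blockwise_constant\<close> permits.\<close>
  also have "(\<Sum>j<m * n + (q + 1). c m (j + 1))
      = m * (\<Sum>i<n. c m (m * i + 1)) + (q + 1) * c m (m * n + 1)"
    using sum_blockwise_constant[of m "\<lambda>j. c m (j + 1)" "q + 1" n] q
      c_rec[OF assms(1)] c_rec[OF assms(1), of 0] by simp
  finally have "c m (m * (m * n + q + 1) + 1)
      = (1 + (q + 1) * c m (m * n + 1)) + m * (\<Sum>i<n. c m (m * i + 1))"
    by simp
  then show "[c m (m * (m * n + q + 1) + 1) = 1 + (q + 1) * c m (m * n + 1)] (mod m)"
    unfolding cong_def by (simp only: mod_mult_self2)
  have "(\<Sum>k<m * n + q. bbar m k) = m * (\<Sum>i<n. bbar m (m * i)) + q * bbar m (m * n)"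
    using sum_blockwise_constant[of m "bbar m" q n] q bbar_block[OF assms(1)] by simp
  \<comment> \<open>The doubled sum gives the coefficient \<open>2 * q\<close>; the remaining 1
    comes from \<open>bbar m (m * n + q) = bbar m (m * n)\<close>.\<close>
  then have "bbar m (m * (m * n + q))
      = (2 * q + 1) * bbar m (m * n) + m * (2 * (\<Sum>i<n. bbar m (m * i)))"
    using bbar_mult_eq_sum[OF assms(1), of "m * n + q"] bbar_block[OF assms(1) q, of n]
    by (simp add: algebra_simps)
  then show "[bbar m (m * (m * n + q)) = (2 * q + 1) * bbar m (m * n)] (mod m)"
    unfolding cong_def by (simp only: mod_mult_self2)
qed

end
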